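(* Let $\Omega$ be a compact metric space, $T:\Omega\to\Omega$ a continuous map, $d\ge 1$, and $A:\Omega\to M_d(\mathbb{R})$ a continuous function into the space of real $d\times d$ matrices. Suppose that (i) $A(y)>0$ (all entries strictly positive) for all $y\in\Omega$; (ii) $\omega\in\Omega$ is a $\nu$-generic point for some $T$-invariant probability measure $\nu$ on $\Omega$. Then the limit $$L(\omega)=\lim_{n\to\infty}\frac1n\log\|A(\omega)A(T\omega)\cdots A(T^{n-1}\omega)\|$$ exists and is equal to $$\Lambda=\lim_{n\to\infty}\frac1n\int_\Omega\log\|A(x)A(Tx)\cdots A(T^{n-1}x)\|\,d\nu(x).$$
   Context: All measures are Borel probability measures. A point $\omega\in\Omega$ is $\nu$-generic if $\frac1n\sum_{k=0}^{n-1}\delta_{T^k\omega}\to\nu$ in the weak-* topology as $n\to\infty$. $\|\cdot\|$ is a fixed norm on $M_d(\mathbb{R})$; for a non-negative matrix $B=(b_{i,j})$ one uses $\|B\|=\sum_{i,j}b_{i,j}$. *)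

theory Defs
  imports "HOL-Probability.Probability"
begin

definition borel_prob :: "'a::topological_space measure \<Rightarrow> bool" where
  "borel_prob \<mu> \<longleftrightarrow> sets \<mu> = sets borel \<and> prob_space \<mu>"

definition invariant_measure :: "('a::topological_space \<Rightarrow> 'a) \<Rightarrow> 'a measure \<Rightarrow> bool" where
  "invariant_measure T \<mu> \<longleftrightarrow> distr \<mu> borel T = \<mu>"

(* Weak-* convergence in the dual of C(Omega), for Omega compact. *)
definition weak_star_conv ::
  "(nat \<Rightarrow> 'a::topological_space measure) \<Rightarrow> 'a measure \<Rightarrow> bool" where
  "weak_star_conv M \<mu> \<longleftrightarrow>
     (\<forall>f :: 'a \<Rightarrow> real. continuous_on UNIV f \<longrightarrow>
        (\<lambda>n. integral\<^sup>L (M n) f) \<longlonglongrightarrow> integral\<^sup>L \<mu> f)"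

(* The average of the Dirac masses at x, T x, ..., T^(n-1) x, written as the image of the
   uniform distribution on {0, ..., n-1} under k \<mapsto> T^k x; see emeasure_empirical_measure.
   For n = 0 it is the zero measure. *)
definition empirical_measure ::
  "('a::topological_space \<Rightarrow> 'a) \<Rightarrow> 'a \<Rightarrow> nat \<Rightarrow> 'a measure" where
  "empirical_measure T x n = distr (uniform_count_measure {..<n}) borel (\<lambda>k. (T ^^ k) x)"

lemma emeasure_empirical_measure:
  assumes "S \<in> sets borel"
  shows "emeasure (empirical_measure T x n) S =
    ennreal (1 / real n) * (\<Sum>k<n. emeasure (return borel ((T ^^ k) x)) S)"
proof -
  let ?I = "{k \<in> {..<n}. (T ^^ k) x \<in> S}"
  have "emeasure (empirical_measure T x n) S =
      emeasure (uniform_count_measure {..<n}) ((\<lambda>k. (T ^^ k) x) -` S \<inter> {..<n})"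
    unfolding empirical_measure_def using assms
    by (subst emeasure_distr)
       (auto simp: measurable_def sets_uniform_count_measure space_uniform_count_measure)
  also have "(\<lambda>k. (T ^^ k) x) -` S \<inter> {..<n} = ?I"
    by auto
  also have "emeasure (uniform_count_measure {..<n}) ?I = ennreal (real (card ?I) / real n)"
    by (subst emeasure_uniform_count_measure) auto
  also have "\<dots> = ennreal (1 / real n) * ennreal (real (card ?I))"
    by (simp flip: ennreal_mult)
  also have "ennreal (real (card ?I)) = (\<Sum>k<n. emeasure (return borel ((T ^^ k) x)) S)"
    using assms
    by (simp add: indicator_def sum.If_cases Int_def ennreal_of_nat_eq_real_of_nat)
  finally show ?thesis .
qed

definition generic_point ::
  "('a::topological_space \<Rightarrow> 'a) \<Rightarrow> 'a measure \<Rightarrow> 'a \<Rightarrow> bool" where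
  "generic_point T \<nu> x \<longleftrightarrow> weak_star_conv (empirical_measure T x) \<nu>"

definition is_norm :: "('v::real_vector \<Rightarrow> real) \<Rightarrow> bool" where
  "is_norm N \<longleftrightarrow>
     (\<forall>x. 0 \<le> N x) \<and> (\<forall>x. N x = 0 \<longleftrightarrow> x = 0) \<and>
     (\<forall>c x. N (c *\<^sub>R x) = \<bar>c\<bar> * N x) \<and> (\<forall>x y. N (x + y) \<le> N x + N y)"

(* cocycle T A n x = A(x) A(T x) ... A(T^(n-1) x): factors along the orbit from left to right. *)
primrec cocycle ::
  "('a \<Rightarrow> 'a) \<Rightarrow> ('a \<Rightarrow> real^'d^'d) \<Rightarrow> nat \<Rightarrow> 'a \<Rightarrow> real^'d^'d" where
  "cocycle T A 0 x = mat 1"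
| "cocycle T A (Suc n) x = cocycle T A n x ** A ((T ^^ n) x)"

end

theory Submission
  imports Defs
begin

text \<open>
  Write \<open>h\<^sub>n x = ln N (A x \<dots> A (T\<^sup>n\<^sup>-\<^sup>1 x))\<close>. The theorem rests on two facts.

  First, \<open>h\<close> is almost additive: \<open>h\<^sub>m\<^sub>+\<^sub>n x\<close> differs from \<open>h\<^sub>m x + h\<^sub>n (T\<^sup>m x)\<close> by at
  most a constant \<open>K\<close> (\<open>ln_norm_cocycle_almost_additive\<close>). By comparability of norms it is
  enough to see this for the sum \<open>S\<close> of the entries. For non-negative matrices \<open>S\<close> is
  submultiplicative, and \<open>S (B C)\<close> is the sum over \<open>k\<close> of the \<open>k\<close>-th column sum of \<open>B\<close> times
  the \<open>k\<close>-th row sum of \<open>C\<close>. By compactness the ratios of entries in a common row of \<open>A y\<close> are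
  bounded uniformly in \<open>y\<close>; this bound is inherited by the column sums of every product
  \<open>B\<close> of such matrices, so each column carries a fixed proportion of \<open>S B\<close>, and
  \<open>S B * S C\<close> is at most a constant times \<open>S (B C)\<close>.

  Second, an almost additive sequence of continuous functions behaves along a generic orbit like
  its averages (\<open>almost_additive_generic_limit\<close>). Summing \<open>h\<^sub>k\<^sub>+\<^sub>n x \<approx> h\<^sub>k x + h\<^sub>n (T\<^sup>k x)\<close> over
  \<open>k < p\<close> makes the left and right sums telescope, which shows that \<open>n h\<^sub>p x\<close> is the Birkhoff
  sum of \<open>h\<^sub>n\<close> of length \<open>p\<close> up to an error \<open>p K + O(1)\<close> as \<open>p\<close> grows. Dividing by \<open>n p\<close>
  and using that the Birkhoff averages of the continuous function \<open>h\<^sub>n\<close> along the orbit of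
  \<open>\<omega>\<close> converge to its integral, all limit points of \<open>h\<^sub>p \<omega> / p\<close> are within \<open>K / n\<close> of
  \<open>(1 / n) \<integral> h\<^sub>n d\<nu>\<close>. Letting \<open>n\<close> grow, both sequences converge, to the same limit.
\<close>

section \<open>Almost additive sequences along a generic orbit\<close>

lemma shift_sum_exchange:
  fixes a :: "nat \<Rightarrow> real"
  shows "(\<Sum>k<p. a (k + n) - a k) = (\<Sum>j<n. a (p + j) - a j)"
proof (induction p)
  case (Suc p)
  have "(\<Sum>j<n. a (Suc p + j) - a (p + j)) = a (p + n) - a p"
    using sum_lessThan_telescope[of "\<lambda>j. a (p + j)" n] by simp
  then show ?case using Suc by (simp add: sum_subtractf)
qed simp

text \<open>
  Summing almost additivity over the splittings of \<open>k + n\<close> into \<open>k\<close> and \<open>n\<close>, for \<open>k < p\<close>, expresses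
  the Birkhoff sum through \<open>h (k + n) x - h k x\<close>; there all but \<open>n\<close> terms at each end cancel,
  and the \<open>n\<close> surviving upper terms \<open>h (p + j) x\<close> are each close to \<open>h p x\<close>. For fixed \<open>n\<close> the
  last sum in the bound stays bounded as \<open>p\<close> grows once every \<open>h j\<close> is bounded.
\<close>
lemma almost_additive_near_Birkhoff_sum:
  fixes h :: "nat \<Rightarrow> 'a \<Rightarrow> real"
  assumes add: "\<And>m n x. \<bar>h (m + n) x - h m x - h n ((T ^^ m) x)\<bar> \<le> K"
  shows "\<bar>real n * h p x - (\<Sum>k<p. h n ((T ^^ k) x))\<bar>
    \<le> (real p + real n) * K + (\<Sum>j<n. \<bar>h j ((T ^^ p) x)\<bar> + \<bar>h j x\<bar>)"
proof -
  define E where "E m n = h (m + n) x - h m x - h n ((T ^^ m) x)" for m n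
  define R where "R = (\<Sum>j<n. h j ((T ^^ p) x) - h j x)"
  have "(\<Sum>k<p. h n ((T ^^ k) x)) + (\<Sum>k<p. E k n) = (\<Sum>k<p. h (k + n) x - h k x)"
    by (simp add: E_def flip: sum.distrib)
  also have "\<dots> = (\<Sum>j<n. h (p + j) x - h j x)"
    by (rule shift_sum_exchange)
  also have "\<dots> = real n * h p x + (\<Sum>j<n. E p j) + R"
    by (simp add: E_def R_def sum.distrib sum_subtractf)
  finally have eq: "real n * h p x - (\<Sum>k<p. h n ((T ^^ k) x))
      = (\<Sum>k<p. E k n) - (\<Sum>j<n. E p j) - R"
    by simp
  have "\<bar>\<Sum>k<p. E k n\<bar> \<le> real p * K"
    using sum_norm_bound[of "{..<p}" "\<lambda>k. E k n" K] add by (simp add: E_def)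
  moreover have "\<bar>\<Sum>j<n. E p j\<bar> \<le> real n * K"
    using sum_norm_bound[of "{..<n}" "\<lambda>j. E p j" K] add by (simp add: E_def)
  moreover have "\<bar>R\<bar> \<le> (\<Sum>j<n. \<bar>h j ((T ^^ p) x)\<bar> + \<bar>h j x\<bar>)"
    unfolding R_def by (rule order_trans[OF sum_abs]) (intro sum_mono, linarith)
  ultimately show ?thesis
    unfolding eq distrib_right by linarith
qed

lemma integral_empirical_measure:
  fixes f :: "'a::topological_space \<Rightarrow> real"
  assumes "f \<in> borel_measurable borel"
  shows "integral\<^sup>L (empirical_measure T x n) f = (\<Sum>k<n. f ((T ^^ k) x)) / real n"
proof -
  have "integral\<^sup>L (empirical_measure T x n) f
      = (\<integral>k. f ((T ^^ k) x) \<partial>uniform_count_measure {..<n})"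
    unfolding empirical_measure_def
    by (rule integral_distr)
       (use assms in \<open>auto simp: measurable_def sets_uniform_count_measure space_uniform_count_measure\<close>)
  also have "\<dots> = (\<Sum>k<n. f ((T ^^ k) x)) / real n"
    by (simp add: integral_uniform_count_measure)
  finally show ?thesis .
qed

lemma generic_point_Birkhoff_average:
  fixes f :: "'a::topological_space \<Rightarrow> real"
  assumes "generic_point T \<nu> \<omega>" "continuous_on UNIV f"
  shows "(\<lambda>p. (\<Sum>k<p. f ((T ^^ k) \<omega>)) / real p) \<longlonglongrightarrow> integral\<^sup>L \<nu> f"
proof -
  have "f \<in> borel_measurable borel"
    using assms(2) by (rule borel_measurable_continuous_onI)
  note integral_empirical_measure[OF this, of T \<omega>]
  moreover have "(\<lambda>p. integral\<^sup>L (empirical_measure T \<omega> p) f) \<longlonglongrightarrow> integral\<^sup>L \<nu> f"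
    using assms unfolding generic_point_def weak_star_conv_def by blast
  ultimately show ?thesis by simp
qed

text \<open>
  The error in the preceding estimate, divided by \<open>n * p\<close>, tends to \<open>K / n\<close> as \<open>p\<close> grows. So the
  orbit averages eventually stay close to the single number \<open>g n\<close>, which makes them Cauchy, and
  the same estimate then forces \<open>g\<close> to converge to their limit.
\<close>
lemma almost_additive_generic_limit:
  fixes h :: "nat \<Rightarrow> 'a::metric_space \<Rightarrow> real"
  assumes cpt: "compact (UNIV :: 'a set)"
    and cont: "\<And>n. continuous_on UNIV (h n)"
    and add: "\<And>m n x. \<bar>h (m + n) x - h m x - h n ((T ^^ m) x)\<bar> \<le> K"
    and gen: "generic_point T \<nu> \<omega>"
  shows "\<exists>\<Lambda>. (\<lambda>n. 1 / real n * (\<integral>x. h n x \<partial>\<nu>)) \<longlonglongrightarrow> \<Lambda> \<and>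
    (\<lambda>n. 1 / real n * h n \<omega>) \<longlonglongrightarrow> \<Lambda>"
proof -
  define u where "u p = 1 / real p * h p \<omega>" for p
  define g where "g n = 1 / real n * (\<integral>x. h n x \<partial>\<nu>)" for n
  have "\<exists>M. \<forall>x. \<bar>h n x\<bar> \<le> M" for n
    using compact_imp_bounded[OF compact_continuous_image[OF cont cpt, of n]]
    by (auto simp: bounded_iff)
  then obtain M where M: "\<And>n x. \<bar>h n x\<bar> \<le> M n" by metis
  \<comment> \<open>The limiting error is \<open>K / n\<close>; the extra \<open>1 / n\<close> absorbs the terms that vanish as \<open>p\<close> grows.\<close>
  have key: "\<forall>\<^sub>F p in sequentially. \<bar>u p - g n\<bar> \<le> (K + 1) / real n" if n: "n > 0" for n
  proof -
    define b where "b p = (\<Sum>k<p. h n ((T ^^ k) \<omega>)) / real p" for p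
    define B where "B = (\<Sum>j<n. M j + M j)"
    have bound: "\<bar>real n * u p - b p\<bar> \<le> K + (real n * K + B) / real p" if p: "p > 0" for p
    proof -
      have "\<bar>real n * h p \<omega> - (\<Sum>k<p. h n ((T ^^ k) \<omega>))\<bar> \<le> (real p + real n) * K + B"
        unfolding B_def
        by (rule order_trans[OF almost_additive_near_Birkhoff_sum[where h = h, OF add]])
           (intro add_mono sum_mono M order_refl)
      then have "\<bar>real n * h p \<omega> - (\<Sum>k<p. h n ((T ^^ k) \<omega>))\<bar> / real p
          \<le> ((real p + real n) * K + B) / real p"
        by (rule divide_right_mono) simp
      moreover have "\<bar>real n * h p \<omega> - (\<Sum>k<p. h n ((T ^^ k) \<omega>))\<bar> / real p = \<bar>real n * u p - b p\<bar>"
        using p by (simp add: u_def b_def flip: diff_divide_distrib)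
      moreover have "((real p + real n) * K + B) / real p = K + (real n * K + B) / real p"
        using p by (simp add: field_simps)
      ultimately show ?thesis by simp
    qed
    have "(\<lambda>p. (real n * K + B) / real p + \<bar>b p - (\<integral>x. h n x \<partial>\<nu>)\<bar>)
        \<longlonglongrightarrow> 0 + \<bar>(\<integral>x. h n x \<partial>\<nu>) - (\<integral>x. h n x \<partial>\<nu>)\<bar>"
      unfolding b_def
      by (intro tendsto_intros lim_const_over_n generic_point_Birkhoff_average gen cont)
    then have "\<forall>\<^sub>F p in sequentially.
        (real n * K + B) / real p + \<bar>b p - (\<integral>x. h n x \<partial>\<nu>)\<bar> < 1"
      by (rule order_tendstoD(2)) simp
    then show ?thesis
      using eventually_gt_at_top[of 0]
    proof eventually_elim
      case (elim p)
      have "real n * \<bar>u p - g n\<bar> = \<bar>real n * (u p - g n)\<bar>"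
        by (simp add: abs_mult)
      also have "\<dots> = \<bar>real n * u p - (\<integral>x. h n x \<partial>\<nu>)\<bar>"
        using n by (simp add: g_def right_diff_distrib)
      also have "\<dots> \<le> K + 1"
        using elim(1) bound[OF elim(2)] by linarith
      finally show ?case using n by (simp add: field_simps)
    qed
  qed
  have small: "(\<lambda>n. (K + 1) / real n) \<longlonglongrightarrow> 0"
    by (rule lim_const_over_n)
  have "Cauchy u"
  proof (rule metric_CauchyI)
    fix e :: real assume "e > 0"
    then have "\<forall>\<^sub>F n in sequentially. (K + 1) / real n < e / 2"
      by (intro order_tendstoD(2)[OF small]) simp
    then obtain n where n: "n > 0" "(K + 1) / real n < e / 2"
      using eventually_happens'[OF _ eventually_conj[OF eventually_gt_at_top[of 0]]]
      by (metis (no_types, lifting) sequentially_bot)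
    from key[OF n(1)] obtain p0 where "\<And>p. p \<ge> p0 \<Longrightarrow> \<bar>u p - g n\<bar> \<le> (K + 1) / real n"
      by (auto simp: eventually_sequentially)
    then have "dist (u p) (u q) < e" if "p \<ge> p0" "q \<ge> p0" for p q
      using that n(2) unfolding dist_real_def by (smt (verit) field_sum_of_halves)
    then show "\<exists>p0. \<forall>p\<ge>p0. \<forall>q\<ge>p0. dist (u p) (u q) < e" by blast
  qed
  then obtain \<Lambda> where u: "u \<longlonglongrightarrow> \<Lambda>"
    using Cauchy_convergent convergent_def by blast
  have "\<bar>\<Lambda> - g n\<bar> \<le> (K + 1) / real n" if "n > 0" for n
    by (rule tendsto_upperbound[OF _ key[OF that]]) (auto intro!: tendsto_intros u)
  then have "\<forall>\<^sub>F n in sequentially. norm (g n - \<Lambda>) \<le> (K + 1) / real n"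
    by (intro eventually_mono[OF eventually_gt_at_top[of 0]]) (simp add: abs_minus_commute)
  then have "(\<lambda>n. g n - \<Lambda>) \<longlonglongrightarrow> 0"
    using small by (rule Lim_null_comparison)
  then have "g \<longlonglongrightarrow> \<Lambda>"
    by (simp add: LIM_zero_iff)
  with u show ?thesis unfolding u_def g_def by blast
qed

section \<open>Comparability of norms on a Euclidean space\<close>

lemma is_norm_sum_le:
  assumes "is_norm N"
  shows "N (\<Sum>i\<in>I. f i) \<le> (\<Sum>i\<in>I. N (f i))"
proof -
  have zero: "N 0 = 0" and tri: "\<And>x y. N (x + y) \<le> N x + N y"
    using assms unfolding is_norm_def by blast+
  show ?thesis
  proof (induction I rule: infinite_finite_induct)
    case (insert i I)
    then show ?case using tri[of "f i" "\<Sum>i\<in>I. f i"] by simp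
  qed (simp_all add: zero)
qed

lemma is_norm_le_norm:
  fixes N :: "'v::euclidean_space \<Rightarrow> real"
  assumes "is_norm N"
  shows "\<exists>C\<ge>0. \<forall>x. N x \<le> C * norm x"
proof (intro exI conjI allI)
  have nn: "\<And>x. 0 \<le> N x" and scale: "\<And>c x. N (c *\<^sub>R x) = \<bar>c\<bar> * N x"
    using assms by (auto simp: is_norm_def)
  show "(\<Sum>b\<in>Basis. N b) \<ge> 0" by (intro sum_nonneg nn)
  fix x :: 'v
  have "N x = N (\<Sum>b\<in>Basis. (x \<bullet> b) *\<^sub>R b)" by (simp add: euclidean_representation)
  also have "\<dots> \<le> (\<Sum>b\<in>Basis. \<bar>x \<bullet> b\<bar> * N b)"
    using is_norm_sum_le[OF assms, of "\<lambda>b. (x \<bullet> b) *\<^sub>R b" Basis] by (simp add: scale)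
  also have "\<dots> \<le> (\<Sum>b\<in>Basis. norm x * N b)"
    by (intro sum_mono mult_right_mono Basis_le_norm nn)
  finally show "N x \<le> (\<Sum>b\<in>Basis. N b) * norm x"
    by (simp add: sum_distrib_left mult.commute)
qed

lemma is_norm_continuous_on:
  fixes N :: "'v::euclidean_space \<Rightarrow> real"
  assumes "is_norm N"
  shows "continuous_on S N"
proof -
  obtain C where C: "C \<ge> 0" "\<And>x. N x \<le> C * norm x"
    using is_norm_le_norm[OF assms] by blast
  have tri: "\<And>x y. N (x + y) \<le> N x + N y"
    using assms by (auto simp: is_norm_def)
  have "N x - N y \<le> C * dist x y" for x y
    using tri[of "x - y" y] C(2)[of "x - y"] by (simp add: dist_norm)
  then have "dist (N x) (N y) \<le> C * dist x y" for x y
    by (smt (verit) dist_commute dist_real_def)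
  then have "C-lipschitz_on S N"
    using C(1) by (simp add: lipschitz_on_def)
  then show ?thesis by (rule lipschitz_on_continuous_on)
qed

text \<open>
  By compactness \<open>N\<close> attains a minimum on the unit sphere, which is positive by definiteness;
  scaling to the sphere gives the bound.
\<close>
lemma norm_le_is_norm:
  fixes N :: "'v::euclidean_space \<Rightarrow> real"
  assumes "is_norm N"
  shows "\<exists>C\<ge>0. \<forall>x. norm x \<le> C * N x"
proof -
  have nn: "\<And>x. 0 \<le> N x" and zero: "\<And>x. N x = 0 \<longleftrightarrow> x = 0"
    and scale: "\<And>c x. N (c *\<^sub>R x) = \<bar>c\<bar> * N x"
    using assms by (auto simp: is_norm_def)
  have "\<exists>s\<in>sphere 0 1. \<forall>y\<in>sphere (0::'v) 1. N s \<le> N y"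
    by (intro continuous_attains_inf compact_sphere is_norm_continuous_on assms) simp
  then obtain s :: 'v where s: "norm s = 1" "\<And>y. norm y = 1 \<Longrightarrow> N s \<le> N y"
    by auto
  have pos: "N s > 0"
    using nn[of s] zero[of s] s(1) by (metis less_eq_real_def norm_zero zero_neq_one)
  have "norm x \<le> 1 / N s * N x" for x
  proof (cases "x = 0")
    case False
    have "N s \<le> N (inverse (norm x) *\<^sub>R x)"
      by (rule s(2)) (use False in simp)
    then show ?thesis using pos False by (simp add: scale field_simps)
  qed (use pos nn in simp)
  then show ?thesis using pos by (intro exI[of _ "1 / N s"]) simp
qed

lemma is_norm_comparable:
  fixes N N' :: "'v::euclidean_space \<Rightarrow> real"
  assumes "is_norm N" "is_norm N'"
  shows "\<exists>D\<ge>1. \<forall>x. N x \<le> D * N' x \<and> N' x \<le> D * N x"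
proof -
  have le: "\<exists>C. \<forall>x. P x \<le> C * Q x" if P: "is_norm P" and Q: "is_norm Q"
    for P Q :: "'v \<Rightarrow> real"
  proof -
    obtain C C' where C: "C \<ge> 0" "\<And>x. P x \<le> C * norm x" and C': "\<And>x. norm x \<le> C' * Q x"
      using is_norm_le_norm[OF P] norm_le_is_norm[OF Q] by blast
    have "P x \<le> (C * C') * Q x" for x
      using C(2)[of x] mult_left_mono[OF C'[of x] C(1)] by (simp add: mult.assoc)
    then show ?thesis by blast
  qed
  obtain C C' where C: "\<And>x. N x \<le> C * N' x" and C': "\<And>x. N' x \<le> C' * N x"
    using le[OF assms] le[OF assms(2,1)] by blast
  have nn: "\<And>x. 0 \<le> N x" "\<And>x. 0 \<le> N' x" using assms by (auto simp: is_norm_def)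
  define D where "D = max 1 (max C C')"
  have "N x \<le> D * N' x \<and> N' x \<le> D * N x" for x
    using order_trans[OF C[of x] mult_right_mono[OF _ nn(2)]]
      order_trans[OF C'[of x] mult_right_mono[OF _ nn(1)]]
    by (simp add: D_def)
  then show ?thesis by (intro exI[of _ D]) (auto simp: D_def)
qed

section \<open>Entry sums of products of non-negative matrices\<close>

text \<open>
  Absolute values make this a norm on all matrices, so that it can be compared with any other
  norm; on non-negative matrices it is the sum of the entries.
\<close>
definition entry_norm :: "real^'d^'d \<Rightarrow> real" where
  "entry_norm B = (\<Sum>i\<in>UNIV. \<Sum>j\<in>UNIV. \<bar>B $ i $ j\<bar>)"

lemma is_norm_entry_norm: "is_norm (entry_norm :: real^'d^'d \<Rightarrow> real)"
  unfolding is_norm_def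
proof (intro conjI allI)
  fix B C :: "real^'d^'d" and c :: real
  show "0 \<le> entry_norm B" by (simp add: entry_norm_def sum_nonneg)
  show "entry_norm B = 0 \<longleftrightarrow> B = 0"
    by (simp add: entry_norm_def sum_nonneg_eq_0_iff sum_nonneg vec_eq_iff)
  show "entry_norm (c *\<^sub>R B) = \<bar>c\<bar> * entry_norm B"
    by (simp add: entry_norm_def abs_mult sum_distrib_left)
  show "entry_norm (B + C) \<le> entry_norm B + entry_norm C"
    unfolding entry_norm_def sum.distrib[symmetric]
    by (intro sum_mono) (simp add: abs_triangle_ineq)
qed

definition col_sum :: "real^'d^'d \<Rightarrow> 'd \<Rightarrow> real" where
  "col_sum B k = (\<Sum>i\<in>UNIV. B $ i $ k)"

lemma entry_norm_eq_col_sums: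
  assumes "\<And>i j. B $ i $ j \<ge> 0"
  shows "entry_norm B = (\<Sum>k\<in>UNIV. col_sum B k)"
  unfolding entry_norm_def col_sum_def using assms by (subst sum.swap) simp

lemma matrix_mult_nonneg:
  fixes B C :: "real^'d^'d"
  assumes "\<And>i j. B $ i $ j \<ge> 0" "\<And>i j. C $ i $ j \<ge> 0"
  shows "(B ** C) $ i $ j \<ge> 0"
  using assms by (simp add: matrix_matrix_mult_def sum_nonneg)

lemma entry_norm_mult:
  fixes B C :: "real^'d^'d"
  assumes "\<And>i j. B $ i $ j \<ge> 0" "\<And>i j. C $ i $ j \<ge> 0"
  shows "entry_norm (B ** C) = (\<Sum>k\<in>UNIV. col_sum B k * (\<Sum>j\<in>UNIV. C $ k $ j))"
proof -
  have "entry_norm (B ** C) = (\<Sum>i\<in>UNIV. \<Sum>j\<in>UNIV. \<Sum>k\<in>UNIV. B $ i $ k * C $ k $ j)"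
    unfolding entry_norm_def using matrix_mult_nonneg[OF assms]
    by (simp add: matrix_matrix_mult_def)
  also have "\<dots> = (\<Sum>i\<in>UNIV. \<Sum>k\<in>UNIV. \<Sum>j\<in>UNIV. B $ i $ k * C $ k $ j)"
    by (rule sum.cong[OF refl], rule sum.swap)
  also have "\<dots> = (\<Sum>k\<in>UNIV. \<Sum>i\<in>UNIV. \<Sum>j\<in>UNIV. B $ i $ k * C $ k $ j)"
    by (rule sum.swap)
  also have "\<dots> = (\<Sum>k\<in>UNIV. col_sum B k * (\<Sum>j\<in>UNIV. C $ k $ j))"
    by (simp add: col_sum_def sum_product)
  finally show ?thesis .
qed

lemma entry_norm_mult_le:
  fixes B C :: "real^'d^'d"
  assumes B: "\<And>i j. B $ i $ j \<ge> 0" and C: "\<And>i j. C $ i $ j \<ge> 0"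
  shows "entry_norm (B ** C) \<le> entry_norm B * entry_norm C"
proof -
  have "col_sum B k \<le> entry_norm B" for k
    unfolding entry_norm_eq_col_sums[OF B]
    by (rule member_le_sum) (auto simp: col_sum_def B sum_nonneg)
  then have "entry_norm (B ** C) \<le> (\<Sum>k\<in>UNIV. entry_norm B * (\<Sum>j\<in>UNIV. C $ k $ j))"
    unfolding entry_norm_mult[OF assms]
    by (intro sum_mono mult_right_mono) (auto simp: C sum_nonneg)
  also have "\<dots> = entry_norm B * entry_norm C"
    using C by (simp add: entry_norm_def[of C] sum_distrib_left)
  finally show ?thesis .
qed

text \<open>
  Submultiplicativity can be reversed when the columns of the left factor are balanced: comparing
  one column sum with the average over all \<open>CARD('d)\<close> columns shows that it is at least
  \<open>entry_norm B / (CARD('d) * \<kappa>)\<close>, so no row of \<open>C\<close> is met by a negligible column of \<open>B\<close>.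
\<close>
lemma entry_norm_mult_ge:
  fixes B C :: "real^'d^'d"
  assumes B: "\<And>i j. B $ i $ j \<ge> 0" and C: "\<And>i j. C $ i $ j \<ge> 0"
    and cols: "\<And>j k. col_sum B j \<le> \<kappa> * col_sum B k"
  shows "entry_norm B * entry_norm C \<le> real CARD('d) * \<kappa> * entry_norm (B ** C)"
proof -
  have "entry_norm B \<le> real CARD('d) * \<kappa> * col_sum B k" for k
    unfolding entry_norm_eq_col_sums[OF B]
    using sum_bounded_above[of UNIV "col_sum B" "\<kappa> * col_sum B k"] cols
    by (simp add: mult.assoc)
  then have "(\<Sum>k\<in>UNIV. entry_norm B * (\<Sum>j\<in>UNIV. C $ k $ j))
      \<le> (\<Sum>k\<in>UNIV. real CARD('d) * \<kappa> * col_sum B k * (\<Sum>j\<in>UNIV. C $ k $ j))"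
    by (intro sum_mono mult_right_mono) (auto simp: C sum_nonneg)
  also have "\<dots> = real CARD('d) * \<kappa> * entry_norm (B ** C)"
    unfolding entry_norm_mult[OF B C] by (simp add: sum_distrib_left mult.assoc)
  also have "(\<Sum>k\<in>UNIV. entry_norm B * (\<Sum>j\<in>UNIV. C $ k $ j)) = entry_norm B * entry_norm C"
    using C by (simp add: entry_norm_def[of C] sum_distrib_left)
  finally show ?thesis .
qed

lemma col_sum_mult:
  "col_sum (B ** C) j = (\<Sum>k\<in>UNIV. col_sum B k * C $ k $ j)"
  unfolding col_sum_def matrix_matrix_mult_def
  by (simp add: sum_distrib_right) (rule sum.swap)

section \<open>Positive matrix cocycles\<close>

lemma cocycle_add:
  "cocycle T A (m + n) x = cocycle T A m x ** cocycle T A n ((T ^^ m) x)"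
proof (induction n)
  case (Suc n)
  have "(T ^^ (m + n)) x = (T ^^ n) ((T ^^ m) x)"
    by (subst add.commute) (simp add: funpow_add)
  with Suc show ?case by (simp add: matrix_mul_assoc)
qed simp

lemma cocycle_nonneg:
  fixes A :: "'a \<Rightarrow> real^'d^'d"
  assumes pos: "\<And>y i j. A y $ i $ j > 0"
  shows "cocycle T A n x $ i $ j \<ge> 0"
proof (induction n arbitrary: i j)
  case (Suc n)
  show ?case
    unfolding cocycle.simps by (intro matrix_mult_nonneg Suc less_imp_le pos)
qed (simp add: mat_def)

text \<open>
  The columns of a product are governed by its last factor: a column sum of \<open>B ** A y\<close> is a
  non-negative combination, with weights depending only on \<open>B\<close>, of the entries in that column of
  \<open>A y\<close>, so the bound on ratios within the rows of \<open>A y\<close> carries over with the same constant,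
  however long the product is. The empty product, the identity, has equal column sums.
\<close>
lemma col_sum_cocycle_comparable:
  fixes A :: "'a \<Rightarrow> real^'d^'d"
  assumes pos: "\<And>y i j. A y $ i $ j > 0"
    and ratio: "\<And>y i j k. A y $ i $ j \<le> \<kappa> * A y $ i $ k"
  shows "col_sum (cocycle T A n x) j \<le> \<kappa> * col_sum (cocycle T A n x) k"
proof (cases n)
  case 0
  have "1 \<le> \<kappa>" using ratio[of x j j j] pos[of x j j] by simp
  then show ?thesis by (simp add: 0 col_sum_def mat_def)
next
  case (Suc m)
  have "col_sum (cocycle T A m x) l * A y $ l $ j
      \<le> \<kappa> * (col_sum (cocycle T A m x) l * A y $ l $ k)" for l y
    using mult_left_mono[OF ratio[of y l j k], of "col_sum (cocycle T A m x) l"]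
    by (simp add: col_sum_def sum_nonneg cocycle_nonneg[OF pos] mult.left_commute)
  then show ?thesis
    unfolding Suc cocycle.simps col_sum_mult sum_distrib_left by (rule sum_mono)
qed

lemma cocycle_neq_0:
  fixes A :: "'a \<Rightarrow> real^'d^'d"
  assumes pos: "\<And>y i j. A y $ i $ j > 0"
  shows "cocycle T A n x \<noteq> 0"
proof -
  have "col_sum (cocycle T A n x) k > 0" for k
  proof (induction n arbitrary: k)
    case 0
    show ?case by (simp add: col_sum_def mat_def)
  next
    case (Suc n)
    then show ?case
      unfolding cocycle.simps col_sum_mult by (intro sum_pos mult_pos_pos pos) auto
  qed
  moreover have "col_sum (0 :: real^'d^'d) k = 0" for k
    by (simp add: col_sum_def)
  ultimately show ?thesis by (metis less_irrefl)
qed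

lemma cocycle_entry_ratio_bounded:
  fixes A :: "'a::metric_space \<Rightarrow> real^'d^'d"
  assumes cpt: "compact (UNIV :: 'a set)" and cont: "continuous_on UNIV A"
    and pos: "\<And>y i j. A y $ i $ j > 0"
  shows "\<exists>\<kappa>. \<forall>y i j k. A y $ i $ j \<le> \<kappa> * A y $ i $ k"
proof -
  have "\<exists>c. \<forall>y. A y $ i $ j / A y $ i $ k \<le> c" for i j k
  proof -
    have "continuous_on UNIV (\<lambda>y. A y $ i $ j / A y $ i $ k)"
      using pos by (intro continuous_intros cont ballI less_imp_neq[symmetric])
    from compact_imp_bounded[OF compact_continuous_image[OF this cpt]]
    obtain c where "\<And>y. \<bar>A y $ i $ j / A y $ i $ k\<bar> \<le> c"
      by (auto simp: bounded_iff)
    then have "A y $ i $ j / A y $ i $ k \<le> c" for y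
      by (rule order_trans[OF abs_ge_self])
    then show ?thesis by blast
  qed
  then obtain c where c: "\<And>i j k y. A y $ i $ j / A y $ i $ k \<le> c i j k" by metis
  define \<kappa> where "\<kappa> = Max (range (\<lambda>(i, j, k). c i j k))"
  have "c i j k \<le> \<kappa>" for i j k
    unfolding \<kappa>_def by (rule Max_ge) (auto intro: rev_image_eqI[of "(i, j, k)"])
  then have "A y $ i $ j / A y $ i $ k \<le> \<kappa>" for y i j k
    using c order_trans by blast
  then show ?thesis using pos by (auto simp: pos_divide_le_eq)
qed

lemma continuous_on_cocycle:
  fixes A :: "'a::topological_space \<Rightarrow> real^'d^'d"
  assumes T: "continuous_on UNIV T" and A: "continuous_on UNIV A"
  shows "continuous_on UNIV (cocycle T A n)"
proof (induction n)
  case (Suc n)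
  have "continuous_on UNIV (T ^^ n)"
  proof (induction n)
    case (Suc n)
    then show ?case using T by (auto intro: continuous_on_compose2)
  qed (simp add: id_def)
  then have "continuous_on UNIV (\<lambda>x. A ((T ^^ n) x))"
    using A by (auto intro: continuous_on_compose2)
  with Suc show ?case
    unfolding cocycle.simps matrix_matrix_mult_def
    by (intro continuous_on_vec_lambda continuous_intros)
qed simp

lemma ln_norm_cocycle_almost_additive:
  fixes A :: "'a::metric_space \<Rightarrow> real^'d^'d"
  assumes cpt: "compact (UNIV :: 'a set)" and cont: "continuous_on UNIV A"
    and norm: "is_norm N" and pos: "\<And>y i j. A y $ i $ j > 0"
  shows "\<exists>K. \<forall>m n x. \<bar>ln (N (cocycle T A (m + n) x)) - ln (N (cocycle T A m x))
    - ln (N (cocycle T A n ((T ^^ m) x)))\<bar> \<le> K"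
proof -
  obtain \<kappa> where ratio: "\<And>y i j k. A y $ i $ j \<le> \<kappa> * A y $ i $ k"
    using cocycle_entry_ratio_bounded[OF cpt cont pos] by blast
  obtain D where D: "D \<ge> 1" and ND: "\<And>B. N B \<le> D * entry_norm B"
    and DN: "\<And>B. entry_norm B \<le> D * N B"
    using is_norm_comparable[OF norm is_norm_entry_norm] by blast
  \<comment> \<open>Taking \<open>c \<ge> 1\<close> lets one constant serve for both the upper and the lower bound.\<close>
  define c where "c = max 1 (real CARD('d) * \<kappa>)"
  have c: "c \<ge> 1" "real CARD('d) * \<kappa> \<le> c" by (auto simp: c_def)
  have Npos: "N (cocycle T A n x) > 0" for n x
  proof -
    have "N (cocycle T A n x) \<ge> 0" "N (cocycle T A n x) \<noteq> 0"
      using norm cocycle_neq_0[where A = A, OF pos, where T = T and n = n and x = x]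
      unfolding is_norm_def by blast+
    then show ?thesis by simp
  qed
  have S0: "entry_norm B \<ge> 0" for B :: "real^'d^'d"
    by (simp add: entry_norm_def sum_nonneg)
  have "\<bar>ln (N (cocycle T A (m + n) x)) - ln (N (cocycle T A m x))
      - ln (N (cocycle T A n ((T ^^ m) x)))\<bar> \<le> ln (D ^ 3 * c)" for m n x
  proof -
    define P where "P = cocycle T A m x"
    define Q where "Q = cocycle T A n ((T ^^ m) x)"
    have PQ: "cocycle T A (m + n) x = P ** Q"
      unfolding P_def Q_def by (rule cocycle_add)
    have NP: "N P > 0" and NQ: "N Q > 0" and NPQ: "N (P ** Q) > 0"
      using Npos[of "m + n" x] by (auto simp: PQ P_def Q_def Npos)
    have nn: "\<And>i j. P $ i $ j \<ge> 0" "\<And>i j. Q $ i $ j \<ge> 0"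
      unfolding P_def Q_def by (rule cocycle_nonneg[OF pos])+
    have "N (P ** Q) \<le> D * entry_norm (P ** Q)" by (rule ND)
    also have "\<dots> \<le> D * (entry_norm P * entry_norm Q)"
      using D entry_norm_mult_le[OF nn] by simp
    also have "\<dots> \<le> D * ((D * N P) * (D * N Q))"
      using D NP by (intro mult_left_mono mult_mono DN S0) auto
    also have "\<dots> = D ^ 3 * (N P * N Q)" by (simp add: power3_eq_cube)
    also have "\<dots> \<le> D ^ 3 * c * (N P * N Q)"
      using c D NP NQ by (intro mult_right_mono) auto
    finally have up: "N (P ** Q) \<le> D ^ 3 * c * (N P * N Q)" .
    have "N P * N Q \<le> (D * entry_norm P) * (D * entry_norm Q)"
      using D NQ S0 by (intro mult_mono ND) auto
    also have "\<dots> = D ^ 2 * (entry_norm P * entry_norm Q)" by (simp add: power2_eq_square)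
    also have "\<dots> \<le> D ^ 2 * (real CARD('d) * \<kappa> * entry_norm (P ** Q))"
      using D nn unfolding P_def
      by (intro mult_left_mono entry_norm_mult_ge col_sum_cocycle_comparable pos ratio) auto
    also have "\<dots> \<le> D ^ 2 * (c * (D * N (P ** Q)))"
      using D c S0 by (intro mult_left_mono mult_mono DN) auto
    also have "\<dots> = D ^ 3 * c * N (P ** Q)" by (simp add: power3_eq_cube power2_eq_square)
    finally have low: "N P * N Q \<le> D ^ 3 * c * N (P ** Q)" .
    have C: "D ^ 3 * c > 0" using D c by auto
    have "ln (N (P ** Q)) \<le> ln (D ^ 3 * c * (N P * N Q))"
      using up NPQ by (intro ln_mono) auto
    moreover have "ln (N P * N Q) \<le> ln (D ^ 3 * c * N (P ** Q))"
      using low NP NQ by (intro ln_mono) auto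
    moreover have "ln (D ^ 3 * c * (N P * N Q)) = ln (D ^ 3 * c) + (ln (N P) + ln (N Q))"
      by (simp only: ln_mult_pos C NP NQ mult_pos_pos)
    moreover have "ln (D ^ 3 * c * N (P ** Q)) = ln (D ^ 3 * c) + ln (N (P ** Q))"
      by (simp only: ln_mult_pos C NPQ)
    moreover have "ln (N P * N Q) = ln (N P) + ln (N Q)"
      by (simp only: ln_mult_pos NP NQ)
    ultimately show ?thesis
      unfolding PQ P_def[symmetric] Q_def[symmetric] by linarith
  qed
  then show ?thesis by blast
qed

theorem theorem1p1:
  fixes T :: "'a::metric_space \<Rightarrow> 'a"
    and A :: "'a \<Rightarrow> real^'d^'d"
    and N :: "real^'d^'d \<Rightarrow> real"
    and \<nu> :: "'a measure"
    and \<omega> :: 'a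
  assumes "compact (UNIV :: 'a set)"
    and "continuous_on UNIV T"
    and "continuous_on UNIV A"
    and "is_norm N"
    and "\<And>y i j. A y $ i $ j > 0"
    and "borel_prob \<nu>" and "invariant_measure T \<nu>"
    and "generic_point T \<nu> \<omega>"
  shows "\<exists>\<Lambda>::real.
    (\<lambda>n. 1 / real n * (\<integral>x. ln (N (cocycle T A n x)) \<partial>\<nu>)) \<longlonglongrightarrow> \<Lambda> \<and>
    (\<lambda>n. 1 / real n * ln (N (cocycle T A n \<omega>))) \<longlonglongrightarrow> \<Lambda>"
proof -
  have "N (cocycle T A n x) \<noteq> 0" for n x
    using assms(4) cocycle_neq_0[where A = A, OF assms(5), where T = T and n = n and x = x]
    unfolding is_norm_def by blast
  then have cont: "continuous_on UNIV (\<lambda>x. ln (N (cocycle T A n x)))" for n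
    using continuous_on_compose2[OF is_norm_continuous_on[OF assms(4)]
        continuous_on_cocycle[OF assms(2,3)] subset_UNIV]
    by (intro continuous_on_ln) auto
  obtain K where "\<And>m n x. \<bar>ln (N (cocycle T A (m + n) x)) - ln (N (cocycle T A m x))
      - ln (N (cocycle T A n ((T ^^ m) x)))\<bar> \<le> K"
    using ln_norm_cocycle_almost_additive[OF assms(1,3,4,5)] by blast
  from almost_additive_generic_limit[where h = "\<lambda>n x. ln (N (cocycle T A n x))",
      OF assms(1) cont this assms(8)]
  show ?thesis .
qed

end
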